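(* Let $q \geq 7$ be a prime power with $q \equiv 3 \pmod 4$, and let $a, b$ be nonzero elements of $\mathbb{F}_q$ with $(a - 1)(b + 1) \in Q$ and $ab \in Q$. Let $T$ be the $q \times (q+1)$ array defined by \[ T(i, j) = \begin{cases} w_i - \frac{w_i - w_j}{a} & \text{if } j \leq q \text{ and } w_i - w_j \in Q,\\ \left(w_i + \frac{w_i - w_j}{b}\right)' & \text{if } j \leq q \text{ and } w_i - w_j \in N_0,\\ w_i & \text{if } j = q + 1. \end{cases} \] Then $T$ (which is a $(q \times (q+1), 2q)$-triple array) is resolvable.
   Context: Let $\mathbb{F}_q = \{0 = w_1, w_2, \dots, w_q\}$ be the finite field with $q$ elements and $\mathbb{F}_q' = \{w_1', \dots, w_q'\}$ a disjoint copy of it, where $x \mapsto x'$ denotes the copying bijection; the symbol set of $T$ is $\mathbb{F}_q \cup \mathbb{F}_q'$. Let $Q$ be the set of nonzero squares in $\mathbb{F}_q$, $N$ the set of non-squares, and $N_0 = N \cup \{0\}$. An $r \times c$ array is a triple array if no symbol repeats in a row or column, each symbol occurs equally often, any row and column share a constant number of symbols, any two distinct rows share a constant number of symbols, and any two distinct columns share a constant number of symbols; it is known (Preece, Wallis, Yucas) that under the stated hypotheses $T$ is a triple array. For an $r \times c$ triple array with $v$ symbols and replication number $e = rc/v$, let $R_i$ and $C_j$ be the sets of symbols in row $i$ and column $j$. The triple array is called resolvable if $\lambda_{rrc} := \frac{e(e-1)}{r-1}$ and $k := \frac{c}{e}$ are integers and the symbol set can be partitioned into $r$ groups of size $k$ such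 that every $C_j$ contains exactly one symbol from each group, and all symbols of a group lie in exactly the same sets $R_i$. *)

theory Defs
  imports Complex_Main "HOL-Library.Disjoint_Sets" "HOL-Library.Cardinality"
begin

text \<open>An \<open>r \<times> c\<close> array is a function \<open>T\<close> of a row and a column index, considered only on
  \<open>{1..r}\<close> and \<open>{1..c}\<close>.\<close>

definition row_symbols :: "nat \<Rightarrow> (nat \<Rightarrow> nat \<Rightarrow> 's) \<Rightarrow> nat \<Rightarrow> 's set" where
  "row_symbols c T i = (\<lambda>j. T i j) ` {1..c}"

definition col_symbols :: "nat \<Rightarrow> (nat \<Rightarrow> nat \<Rightarrow> 's) \<Rightarrow> nat \<Rightarrow> 's set" where
  "col_symbols r T j = (\<lambda>i. T i j) ` {1..r}"

definition triple_array ::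
  "nat \<Rightarrow> nat \<Rightarrow> nat \<Rightarrow> 's set \<Rightarrow> (nat \<Rightarrow> nat \<Rightarrow> 's) \<Rightarrow> bool" where
  "triple_array r c v V T \<longleftrightarrow>
     finite V \<and> card V = v \<and>
     (\<forall>i\<in>{1..r}. \<forall>j\<in>{1..c}. T i j \<in> V) \<and>
     (\<forall>i\<in>{1..r}. inj_on (\<lambda>j. T i j) {1..c}) \<and>
     (\<forall>j\<in>{1..c}. inj_on (\<lambda>i. T i j) {1..r}) \<and>
     (\<exists>e. \<forall>x\<in>V. card {(i, j). i \<in> {1..r} \<and> j \<in> {1..c} \<and> T i j = x} = e) \<and>
     (\<exists>l. \<forall>i\<in>{1..r}. \<forall>j\<in>{1..c}. card (row_symbols c T i \<inter> col_symbols r T j) = l) \<and>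
     (\<exists>l. \<forall>i\<in>{1..r}. \<forall>i'\<in>{1..r}. i \<noteq> i' \<longrightarrow>
            card (row_symbols c T i \<inter> row_symbols c T i') = l) \<and>
     (\<exists>l. \<forall>j\<in>{1..c}. \<forall>j'\<in>{1..c}. j \<noteq> j' \<longrightarrow>
            card (col_symbols r T j \<inter> col_symbols r T j') = l)"

definition resolvable ::
  "nat \<Rightarrow> nat \<Rightarrow> nat \<Rightarrow> 's set \<Rightarrow> (nat \<Rightarrow> nat \<Rightarrow> 's) \<Rightarrow> bool" where
  "resolvable r c v V T \<longleftrightarrow>
     (let e = real r * real c / real v;
          lambda_rrc = e * (e - 1) / (real r - 1);
          k = real c / e
      in lambda_rrc \<in> \<int> \<and> k \<in> \<int> \<and>
         (\<exists>P. partition_on V P \<and> card P = r \<and>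
              (\<forall>G\<in>P. real (card G) = k) \<and>
              (\<forall>j\<in>{1..c}. \<forall>G\<in>P. \<exists>!x. x \<in> G \<and> x \<in> col_symbols r T j) \<and>
              (\<forall>G\<in>P. \<forall>x\<in>G. \<forall>y\<in>G. \<forall>i\<in>{1..r}.
                 x \<in> row_symbols c T i \<longleftrightarrow> y \<in> row_symbols c T i)))"

definition nonzero_squares :: "'a::field set" where
  "nonzero_squares = {x. x \<noteq> 0 \<and> (\<exists>y. x = y\<^sup>2)}"

definition non_squares :: "'a::field set" where
  "non_squares = {x. \<not> (\<exists>y. x = y\<^sup>2)}"

text \<open>The disjoint union of the field and its copy is the sum type; \<open>Inl x\<close> is the element \<open>x\<close>
  and \<open>Inr x\<close> its copy \<open>x'\<close>. The value \<open>undefined\<close> is never taken at column indices in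
  \<open>{1..q+1}\<close>, as the nonzero squares, the non-squares and \<open>0\<close> exhaust the field.\<close>

definition paley_array ::
  "(nat \<Rightarrow> 'a::{field,finite}) \<Rightarrow> 'a \<Rightarrow> 'a \<Rightarrow> nat \<Rightarrow> nat \<Rightarrow> 'a + 'a" where
  "paley_array w a b i j =
     (if j \<le> CARD('a) \<and> w i - w j \<in> nonzero_squares then Inl (w i - (w i - w j) / a)
      else if j \<le> CARD('a) \<and> w i - w j \<in> non_squares \<union> {0} then Inr (w i + (w i - w j) / b)
      else if j = CARD('a) + 1 then Inl (w i)
      else undefined)"

end

theory Submission
  imports Defs
begin

text \<open>
  Write \<open>Q\<close> for the nonzero squares. As \<open>q \<equiv> 3 (mod 4)\<close>, the element \<open>-1\<close> is not a square, so
  \<open>-Q\<close> is the set of non-squares. The condition \<open>ab \<in> Q\<close> then says that \<open>s\<close> and its copy \<open>s'\<close> both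
  lie in row \<open>x\<close> exactly when \<open>a (s - x) \<notin> Q\<close>, and together with \<open>(a - 1)(b + 1) \<in> Q\<close> it gives, for
  \<open>c = a (a - 1)\<close>, that column \<open>y\<close> contains \<open>s\<close> if \<open>c (s - y) \<in> Q\<close> and \<open>s'\<close> otherwise.
  Hence the pairs \<open>{s, s'}\<close> resolve the array. The intersection numbers are constant because \<open>Q\<close> is a
  difference set: the number of ways to write \<open>t \<noteq> 0\<close> as a difference of two elements of \<open>Q\<close> does not
  change when \<open>t\<close> is multiplied by a square or by \<open>-1\<close>.
\<close>

section \<open>Squares in finite fields\<close>

lemma nonzero_squares_nonzero: "x \<in> nonzero_squares \<Longrightarrow> x \<noteq> 0"
  by (simp add: nonzero_squares_def)

lemma power2_in_nonzero_squares: "x \<noteq> 0 \<Longrightarrow> x\<^sup>2 \<in> nonzero_squares"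
  by (auto simp: nonzero_squares_def)

lemma nonzero_squares_mult:
  "x \<in> nonzero_squares \<Longrightarrow> y \<in> nonzero_squares \<Longrightarrow> x * y \<in> nonzero_squares"
  by (auto simp: nonzero_squares_def simp flip: power_mult_distrib)

lemma nonzero_squares_inverse:
  "x \<in> nonzero_squares \<Longrightarrow> inverse x \<in> nonzero_squares"
  by (auto simp: nonzero_squares_def simp flip: power_inverse)

lemma mult_in_nonzero_squares_iff:
  assumes "x \<in> nonzero_squares"
  shows "x * y \<in> nonzero_squares \<longleftrightarrow> y \<in> nonzero_squares"
proof
  assume "x * y \<in> nonzero_squares"
  then have "inverse x * (x * y) \<in> nonzero_squares"
    by (rule nonzero_squares_mult[OF nonzero_squares_inverse[OF assms]])
  then show "y \<in> nonzero_squares"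
    using nonzero_squares_nonzero[OF assms] by (simp flip: mult.assoc)
qed (use assms nonzero_squares_mult in blast)

text \<open>Multiplying by the square \<open>v\<^sup>2\<close> turns \<open>u * z\<close> into
  \<open>(u * v) * (v * z)\<close>, whose first factor is a square. Coefficients in the same square
  class can thus replace each other in membership tests.\<close>

lemma mult_in_nonzero_squares_cong:
  assumes "u * v \<in> nonzero_squares"
  shows "u * z \<in> nonzero_squares \<longleftrightarrow> v * z \<in> nonzero_squares"
proof -
  have "v \<noteq> 0"
    using nonzero_squares_nonzero[OF assms] by auto
  have "u * z \<in> nonzero_squares \<longleftrightarrow> v\<^sup>2 * (u * z) \<in> nonzero_squares"
    using mult_in_nonzero_squares_iff[OF power2_in_nonzero_squares[OF \<open>v \<noteq> 0\<close>]] by blast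
  also have "v\<^sup>2 * (u * z) = (u * v) * (v * z)"
    by (simp add: power2_eq_square algebra_simps)
  also have "\<dots> \<in> nonzero_squares \<longleftrightarrow> v * z \<in> nonzero_squares"
    using mult_in_nonzero_squares_iff[OF assms] .
  finally show ?thesis .
qed

text \<open>Makes the first two cases of \<open>paley_array\<close> complementary, so that
  \<open>undefined\<close> is ruled out for the column indices up to the field size.\<close>

lemma non_squares_Un_zero: "non_squares \<union> {0} = - nonzero_squares"
  by (auto simp: non_squares_def nonzero_squares_def intro: exI[of _ 0])

text \<open>Multiplication by \<open>x\<close> permutes the nonzero elements, so their product is
  unchanged although it gains one factor \<open>x\<close> per element.\<close>

lemma finite_field_power_card_minus_1:
  fixes x :: "'a::{field,finite}"
  assumes "x \<noteq> 0"
  shows "x ^ (CARD('a) - 1) = 1"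
proof -
  have "bij_betw ((*) x) (UNIV - {0}) (UNIV - {0})"
    by (rule bij_betw_byWitness[where f' = "\<lambda>y. y / x"]) (use assms in auto)
  then have "(\<Prod>y\<in>UNIV - {0}. x * y) = \<Prod>(UNIV - {0})"
    by (rule prod.reindex_bij_betw)
  then have "x ^ (CARD('a) - 1) * \<Prod>(UNIV - {0}) = \<Prod>(UNIV - {0})"
    by (simp add: prod.distrib card_Diff_singleton)
  moreover have "\<Prod>(UNIV - {0::'a}) \<noteq> 0"
    by simp
  ultimately show ?thesis
    by simp
qed

text \<open>Adding 1 permutes the ring, so the sum of all elements is unchanged although it gains 1
  per element.\<close>

lemma of_nat_CARD_eq_0: "of_nat CARD('a) = (0 :: 'a::{ring_1,finite})"
proof -
  have "bij_betw (\<lambda>x. x + 1) UNIV (UNIV :: 'a set)"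
    by (rule bij_betw_byWitness[where f' = "\<lambda>x. x - 1"]) auto
  then have "(\<Sum>x\<in>UNIV. x + 1) = \<Sum>(UNIV :: 'a set)"
    by (rule sum.reindex_bij_betw)
  then show ?thesis
    by (simp add: sum.distrib)
qed

text \<open>If 2 = 0, an odd multiple of 1 equals 1, whereas the multiple by the field size is
  0.\<close>

lemma odd_CARD_imp_neg_one_neq_one:
  assumes "odd CARD('a::{field,finite})"
  shows "- 1 \<noteq> (1::'a)"
proof
  assume "- 1 = (1::'a)"
  then have two: "(2::'a) = 0"
    by (metis add.right_inverse one_add_one)
  obtain m where "CARD('a) = 2 * m + 1"
    using assms by (elim oddE)
  then have "(of_nat CARD('a) :: 'a) = 1"
    using two by simp
  then show False
    by (simp add: of_nat_CARD_eq_0)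
qed

text \<open>Affine maps with nonzero slope are bijections, so preimages keep their size. The third
  form, with \<open>s\<close> and \<open>x\<close> exchanged, serves to count the rows that contain
  a given symbol.\<close>

lemma card_affine_squares:
  fixes c x :: "'a::{field,finite}"
  assumes "c \<noteq> 0"
  shows "card {s. c * (s - x) \<in> nonzero_squares} = card (nonzero_squares :: 'a set)"
    and "card {s. c * (s - x) \<notin> nonzero_squares} = card (- nonzero_squares :: 'a set)"
    and "card {s. c * (x - s) \<notin> nonzero_squares} = card (- nonzero_squares :: 'a set)"
proof -
  have bij: "bij (\<lambda>s. c * (s - x))"
    by (rule bij_betw_byWitness[where f' = "\<lambda>d. d / c + x"]) (use assms in auto)
  have bij': "bij (\<lambda>s. c * (x - s))"
    by (rule bij_betw_byWitness[where f' = "\<lambda>d. x - d / c"]) (use assms in auto)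
  show "card {s. c * (s - x) \<in> nonzero_squares} = card (nonzero_squares :: 'a set)"
    using card_vimage_inj[OF bij_is_inj[OF bij], of nonzero_squares] bij_is_surj[OF bij]
    by (simp add: vimage_def)
  show "card {s. c * (s - x) \<notin> nonzero_squares} = card (- nonzero_squares :: 'a set)"
    using card_vimage_inj[OF bij_is_inj[OF bij], of "- nonzero_squares"] bij_is_surj[OF bij]
    by (simp add: vimage_def)
  show "card {s. c * (x - s) \<notin> nonzero_squares} = card (- nonzero_squares :: 'a set)"
    using card_vimage_inj[OF bij_is_inj[OF bij'], of "- nonzero_squares"] bij_is_surj[OF bij']
    by (simp add: vimage_def)
qed

section \<open>Squares in fields of order 3 modulo 4\<close>

context
  assumes mod4: "CARD('a::{field,finite}) mod 4 = 3"
begin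

lemma neg_one_neq_one: "- 1 \<noteq> (1::'a)"
proof (rule odd_CARD_imp_neg_one_neq_one)
  show "odd CARD('a)"
    using mod4 by presburger
qed

text \<open>Half of \<open>CARD('a) - 1\<close> is odd, so a root \<open>y\<close> of -1 would
  satisfy \<open>y ^ (CARD('a) - 1) = - 1\<close>, while this power is 1.\<close>

lemma neg_one_not_square: "- 1 \<noteq> (y::'a)\<^sup>2"
proof
  assume y: "- 1 = y\<^sup>2"
  have "CARD('a) - 1 = 2 * (2 * (CARD('a) div 4) + 1)"
    using mod4 by presburger
  then have "y ^ (CARD('a) - 1) = (y\<^sup>2) ^ (2 * (CARD('a) div 4) + 1)"
    by (simp only: power_mult)
  also have "\<dots> = - 1"
    by (simp flip: y)
  finally have "y ^ (CARD('a) - 1) = - 1" .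
  moreover have "y \<noteq> 0"
    using y by auto
  ultimately show False
    using finite_field_power_card_minus_1[of y] neg_one_neq_one by simp
qed

text \<open>Squaring is two-to-one on the nonzero elements, because \<open>z\<close> and
  \<open>- z\<close> differ; its fibres over the squares partition these elements.\<close>

lemma card_nonzero_squares: "2 * card (nonzero_squares :: 'a set) = CARD('a) - 1"
proof -
  have "card {y \<in> UNIV - {0}. y\<^sup>2 = x} = 2" if x: "x \<in> nonzero_squares" for x :: 'a
  proof -
    obtain z where "x = z\<^sup>2"
      using x by (auto simp: nonzero_squares_def)
    then have z: "x = z\<^sup>2" "z \<noteq> 0"
      using nonzero_squares_nonzero[OF x] by auto
    have "z \<noteq> - z"
    proof
      assume "z = - z"
      then have "z * 1 = z * (- 1)"
        by simp
      then show False
        using z(2) neg_one_neq_one by (metis mult_left_cancel)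
    qed
    moreover have "{y \<in> UNIV - {0}. y\<^sup>2 = x} = {z, - z}"
      using z by (auto simp: power2_eq_iff)
    ultimately show ?thesis
      by simp
  qed
  moreover have "(\<Sum>x\<in>nonzero_squares. card {y \<in> UNIV - {0::'a}. y\<^sup>2 = x})
      = card (UNIV - {0::'a})"
  proof -
    have "(\<Sum>x\<in>nonzero_squares. card {y \<in> UNIV - {0::'a}. y\<^sup>2 = x})
      = card (\<Union>x\<in>nonzero_squares. {y \<in> UNIV - {0::'a}. y\<^sup>2 = x})"
      by (rule card_UN_disjoint[symmetric]) auto
    also have "(\<Union>x\<in>nonzero_squares. {y \<in> UNIV - {0::'a}. y\<^sup>2 = x}) = UNIV - {0}"
      by (auto simp: nonzero_squares_def)
    finally show ?thesis .
  qed
  ultimately show ?thesis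
    by (simp add: card_Diff_singleton)
qed

text \<open>Since -1 is not a square, Q and -Q are disjoint; each contains half of the nonzero
  elements, so together they exhaust them.\<close>

lemma uminus_in_nonzero_squares_iff:
  fixes x :: 'a
  assumes "x \<noteq> 0"
  shows "- x \<in> nonzero_squares \<longleftrightarrow> x \<notin> nonzero_squares"
proof -
  let ?Q = "nonzero_squares :: 'a set"
  have neg: "- u \<notin> ?Q" if u: "u \<in> ?Q" for u
  proof
    assume "- u \<in> ?Q"
    then have "u * (- 1) \<in> ?Q"
      by simp
    then have "- 1 \<in> ?Q"
      using mult_in_nonzero_squares_iff[OF u] by blast
    then show False
      using neg_one_not_square by (auto simp: nonzero_squares_def)
  qed
  then have disj: "?Q \<inter> uminus ` ?Q = {}"
    by auto
  have "card (?Q \<union> uminus ` ?Q) = card (UNIV - {0::'a})"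
    using disj card_nonzero_squares
    by (simp add: card_Un_disjoint card_image card_Diff_singleton)
  moreover have "?Q \<union> uminus ` ?Q \<subseteq> UNIV - {0}"
    using nonzero_squares_nonzero by auto
  ultimately have "?Q \<union> uminus ` ?Q = UNIV - {0}"
    by (intro card_subset_eq) auto
  then have "x \<in> ?Q \<union> uminus ` ?Q"
    using assms by auto
  then show ?thesis
    using neg by auto
qed

section \<open>The nonzero squares as a difference set\<close>

lemma card_square_differences:
  fixes t :: 'a
  assumes "t \<noteq> 0"
  shows "card {d. d \<in> nonzero_squares \<and> d + t \<in> nonzero_squares}
    = card {d::'a. d \<in> nonzero_squares \<and> d + 1 \<in> nonzero_squares}"
proof -
  define n where "n t = card {d::'a. d \<in> nonzero_squares \<and> d + t \<in> nonzero_squares}" for t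
  have neg: "n (- t) = n t" for t
  proof -
    have "bij_betw (\<lambda>d. d + t) {d. d \<in> nonzero_squares \<and> d + t \<in> nonzero_squares}
        {d. d \<in> nonzero_squares \<and> d + - t \<in> nonzero_squares}"
      by (rule bij_betw_byWitness[where f' = "\<lambda>d. d - t"]) auto
    then show ?thesis
      unfolding n_def using bij_betw_same_card by fastforce
  qed
  have scale: "n t = n 1" if t: "t \<in> nonzero_squares" for t
  proof -
    have "t \<noteq> 0"
      using t nonzero_squares_nonzero by blast
    have "bij_betw ((*) t) {d. d \<in> nonzero_squares \<and> d + 1 \<in> nonzero_squares}
        {d. d \<in> nonzero_squares \<and> d + t \<in> nonzero_squares}"
    proof (rule bij_betw_byWitness[where f' = "\<lambda>d. inverse t * d"])
      show "(*) t ` {d. d \<in> nonzero_squares \<and> d + 1 \<in> nonzero_squares}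
          \<subseteq> {d. d \<in> nonzero_squares \<and> d + t \<in> nonzero_squares}"
      proof clarify
        fix d :: 'a
        assume "d \<in> nonzero_squares" "d + 1 \<in> nonzero_squares"
        then have "t * d \<in> nonzero_squares" "t * (d + 1) \<in> nonzero_squares"
          using t nonzero_squares_mult by blast+
        then show "t * d \<in> nonzero_squares \<and> t * d + t \<in> nonzero_squares"
          by (simp add: algebra_simps)
      qed
      show "(\<lambda>d. inverse t * d) ` {d. d \<in> nonzero_squares \<and> d + t \<in> nonzero_squares}
          \<subseteq> {d. d \<in> nonzero_squares \<and> d + 1 \<in> nonzero_squares}"
      proof clarify
        fix d :: 'a
        assume "d \<in> nonzero_squares" "d + t \<in> nonzero_squares"
        then have "inverse t * d \<in> nonzero_squares" "inverse t * (d + t) \<in> nonzero_squares"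
          using t nonzero_squares_mult nonzero_squares_inverse by blast+
        then show "inverse t * d \<in> nonzero_squares \<and> inverse t * d + 1 \<in> nonzero_squares"
          using \<open>t \<noteq> 0\<close> by (simp add: distrib_left)
      qed
    qed (use \<open>t \<noteq> 0\<close> in auto)
    then show ?thesis
      unfolding n_def using bij_betw_same_card by fastforce
  qed
  have "n t = n 1"
    \<comment> \<open>One of \<open>t\<close> and \<open>- t\<close> is a square and can be scaled
      to 1; \<open>neg\<close> covers the case that it is \<open>- t\<close>.\<close>
    using neg[of t] scale[of t] scale[of "- t"] uminus_in_nonzero_squares_iff[OF assms] by metis
  then show ?thesis
    by (simp add: n_def)
qed

text \<open>Ordered pairs of distinct squares are counted by their difference \<open>t\<close>. With
  k squares there are 2k nonzero differences, each occurring n times, so 2kn = k(k - 1).\<close>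

lemma card_square_differences_value:
  "4 * card {d::'a. d \<in> nonzero_squares \<and> d + 1 \<in> nonzero_squares} + 3 = CARD('a)"
proof -
  let ?Q = "nonzero_squares :: 'a set"
  let ?D = "\<lambda>t. {d. d \<in> ?Q \<and> d + t \<in> ?Q}"
  have "bij_betw (\<lambda>(t, d). (d, d + t)) (SIGMA t:UNIV - {0}. ?D t) (SIGMA d:?Q. ?Q - {d})"
    by (rule bij_betw_byWitness[where f' = "\<lambda>(d, e). (e - d, d)"]) auto
  then have "card (SIGMA t:UNIV - {0}. ?D t) = card (SIGMA d:?Q. ?Q - {d})"
    by (rule bij_betw_same_card)
  then have "(\<Sum>t\<in>UNIV - {0}. card (?D t)) = (\<Sum>d\<in>?Q. card (?Q - {d}))"
    by simp
  also have "\<dots> = card ?Q * (card ?Q - 1)"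
    by (simp add: card_Diff_singleton)
  also have "(\<Sum>t\<in>UNIV - {0}. card (?D t)) = (\<Sum>t\<in>UNIV - {0::'a}. card (?D 1))"
    by (intro sum.cong refl card_square_differences) simp
  also have "\<dots> = card ?Q * (2 * card (?D 1))"
    using card_nonzero_squares by (simp add: card_Diff_singleton)
  finally have "card ?Q * (2 * card (?D 1)) = card ?Q * (card ?Q - 1)" .
  \<comment> \<open>Positivity of \<open>card ?Q\<close> permits the cancellation and excludes
    truncation in \<open>card ?Q - 1\<close>.\<close>
  moreover have "1 \<in> ?Q"
    using power2_in_nonzero_squares[of "1::'a"] by simp
  then have "card ?Q > 0"
    by (auto simp: card_gt_0_iff)
  ultimately have "2 * card (?D 1) = card ?Q - 1"
    by (metis mult_left_cancel less_numeral_extra(3))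
  with \<open>card ?Q > 0\<close> show ?thesis
    using card_nonzero_squares by linarith
qed

text \<open>The substitution \<open>d = c * (s - x)\<close> turns the second condition into one on
  \<open>d + t\<close> with the fixed nonzero shift \<open>t = c * (x - y)\<close>.\<close>

lemma card_affine_squares_Int:
  fixes c x y :: 'a
  assumes "c \<noteq> 0" "x \<noteq> y"
  shows "card ({s. c * (s - x) \<in> nonzero_squares} \<inter> {s. c * (s - y) \<in> nonzero_squares})
    = card {d::'a. d \<in> nonzero_squares \<and> d + 1 \<in> nonzero_squares}"
proof -
  define t where "t = c * (x - y)"
  have t: "t \<noteq> 0" "c * (s - y) = c * (s - x) + t" for s
    using assms by (auto simp: t_def algebra_simps)
  have "bij_betw (\<lambda>s. c * (s - x))
      ({s. c * (s - x) \<in> nonzero_squares} \<inter> {s. c * (s - y) \<in> nonzero_squares})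
      {d. d \<in> nonzero_squares \<and> d + t \<in> nonzero_squares}"
    by (rule bij_betw_byWitness[where f' = "\<lambda>d. d / c + x"]) (use assms t in auto)
  then show ?thesis
    using card_square_differences[OF t(1)] bij_betw_same_card by fastforce
qed

text \<open>Inclusion-exclusion: in a field of size q, two sets of size (q - 1)/2 that meet in m
  elements leave q - (q - 1) + m elements uncovered.\<close>

lemma card_affine_nonsquares_Int:
  fixes c x y :: 'a
  assumes "c \<noteq> 0" "x \<noteq> y"
  shows "card ({s. c * (s - x) \<notin> nonzero_squares} \<inter> {s. c * (s - y) \<notin> nonzero_squares})
    = card {d::'a. d \<in> nonzero_squares \<and> d + 1 \<in> nonzero_squares} + 1"
proof -
  let ?A = "\<lambda>z. {s. c * (s - z) \<in> nonzero_squares}"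
  have "card (?A x \<union> ?A y) + card (?A x \<inter> ?A y) = 2 * card (nonzero_squares :: 'a set)"
    using card_Un_Int[of "?A x" "?A y"] card_affine_squares(1)[OF assms(1)] by simp
  moreover have "card (?A x \<union> ?A y) + card (- (?A x \<union> ?A y)) = CARD('a)"
    by (metis card_Un_disjoint finite Compl_disjoint Compl_partition)
  \<comment> \<open>Excludes truncation in \<open>CARD('a) - 1\<close>.\<close>
  moreover have "CARD('a) > 0"
    by simp
  ultimately have "card (- (?A x \<union> ?A y))
      = card {d::'a. d \<in> nonzero_squares \<and> d + 1 \<in> nonzero_squares} + 1"
    using card_nonzero_squares card_affine_squares_Int[OF assms] by linarith
  moreover have "- (?A x \<union> ?A y)
      = {s. c * (s - x) \<notin> nonzero_squares} \<inter> {s. c * (s - y) \<notin> nonzero_squares}"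
    by auto
  ultimately show ?thesis
    by simp
qed

end

section \<open>Rows and columns of the Paley array\<close>

lemma Plus_Int: "(A <+> B) \<inter> (C <+> D) = (A \<inter> C) <+> (B \<inter> D)"
  by auto

locale paley_parameters =
  fixes w :: "nat \<Rightarrow> 'a::{field,finite}" and a b :: 'a and q :: nat
  assumes CARD_eq: "CARD('a) = q" and mod4: "q mod 4 = 3"
    and bij_w: "bij_betw w {1..q} UNIV"
    and mult_pm_one: "(a - 1) * (b + 1) \<in> nonzero_squares"
    and mult_ab: "a * b \<in> nonzero_squares"
begin

abbreviation "T \<equiv> paley_array w a b"

lemma CARD_mod4: "CARD('a) mod 4 = 3"
  using CARD_eq mod4 by simp

lemma nonzero: "a \<noteq> 0" "b \<noteq> 0" "a - 1 \<noteq> 0" "b + 1 \<noteq> 0"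
  using nonzero_squares_nonzero[OF mult_pm_one] nonzero_squares_nonzero[OF mult_ab] by auto

lemma w_surj: obtains j where "j \<in> {1..q}" "w j = y"
  using bij_w by (metis bij_betw_imp_surj_on imageE UNIV_I)

lemma w_neq: "i \<in> {1..q} \<Longrightarrow> j \<in> {1..q} \<Longrightarrow> i \<noteq> j \<Longrightarrow> w i \<noteq> w j"
  using bij_w by (meson bij_betw_imp_inj_on inj_onD)

lemma T_eq:
  "j \<in> {1..q} \<Longrightarrow> T i j = (if w i - w j \<in> nonzero_squares then Inl (w i - (w i - w j) / a)
     else Inr (w i + (w i - w j) / b))"
  "T i (Suc q) = Inl (w i)"
  unfolding paley_array_def non_squares_Un_zero CARD_eq by simp_all

section \<open>Symbol sets of rows and columns\<close>

definition row_base :: "'a \<Rightarrow> 'a set" where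
  "row_base x = {s. a * (s - x) \<notin> nonzero_squares}"

text \<open>Solving \<open>s = y + d - d / a\<close> gives \<open>d = a / (a - 1) * (s - y)\<close>;
  the coefficient used here is this one times the square \<open>(a - 1)\<^sup>2\<close>.\<close>

definition col_base :: "'a \<Rightarrow> 'a set" where
  "col_base y = {s. (a * (a - 1)) * (s - y) \<in> nonzero_squares}"

text \<open>As the column varies, \<open>d = w i - w j\<close> runs through the field. With
  \<open>x = w i\<close>, the symbol \<open>Inl s\<close> arises from
  \<open>d = - (a * (s - x))\<close> in Q, that is, when \<open>a * (s - x)\<close> is a non-square;
  the last column supplies the missing \<open>s = x\<close>. The symbol \<open>Inr s\<close> arises
  from \<open>d = b * (s - x)\<close> outside Q, where \<open>a\<close> may replace
  \<open>b\<close>.\<close>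

lemma row_symbols_T: "row_symbols (q + 1) T i = row_base (w i) <+> row_base (w i)"
proof -
  let ?x = "w i"
  have split: "{1..q + 1} = insert (Suc q) {1..q}"
    by auto
  have *: "z \<in> row_symbols (q + 1) T i \<longleftrightarrow> z = Inl ?x
      \<or> (\<exists>d. z = (if d \<in> nonzero_squares then Inl (?x - d / a) else Inr (?x + d / b)))" for z
  proof -
    have "z \<in> row_symbols (q + 1) T i \<longleftrightarrow> z = Inl ?x \<or> (\<exists>j\<in>{1..q}. z = T i j)"
      unfolding row_symbols_def split using T_eq(2) by auto
    also have "(\<exists>j\<in>{1..q}. z = T i j) \<longleftrightarrow>
        (\<exists>d. z = (if d \<in> nonzero_squares then Inl (?x - d / a) else Inr (?x + d / b)))"
      (is "_ \<longleftrightarrow> (\<exists>d. z = ?f d)")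
    proof
      assume "\<exists>j\<in>{1..q}. z = T i j"
      then obtain j where "j \<in> {1..q}" "z = T i j" ..
      then have "z = ?f (w i - w j)"
        using T_eq(1) by simp
      then show "\<exists>d. z = ?f d" ..
    next
      assume "\<exists>d. z = ?f d"
      then obtain d where d: "z = ?f d" ..
      obtain j where j: "j \<in> {1..q}" "w j = w i - d"
        by (rule w_surj)
      then have "z = T i j"
        using d T_eq(1)[OF j(1), of i] by simp
      with j show "\<exists>j\<in>{1..q}. z = T i j" by blast
    qed
    finally show ?thesis .
  qed
  have left: "Inl s \<in> row_symbols (q + 1) T i \<longleftrightarrow> s \<in> row_base ?x" for s
  proof (cases "s = ?x")
    case True
    then show ?thesis
      unfolding * by (simp add: row_base_def nonzero_squares_def)
  next
    case False
    have "Inl s \<in> row_symbols (q + 1) T i \<longleftrightarrow> (\<exists>d\<in>nonzero_squares. s = ?x - d / a)"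
      unfolding * using False by (auto split: if_splits)
    also have "\<dots> \<longleftrightarrow> - (a * (s - ?x)) \<in> nonzero_squares"
    proof
      assume "\<exists>d\<in>nonzero_squares. s = ?x - d / a"
      then show "- (a * (s - ?x)) \<in> nonzero_squares"
        using nonzero by auto
    next
      assume "- (a * (s - ?x)) \<in> nonzero_squares"
      moreover have "s = ?x - (- (a * (s - ?x))) / a"
        using nonzero by (simp add: field_simps)
      ultimately show "\<exists>d\<in>nonzero_squares. s = ?x - d / a" by blast
    qed
    also have "\<dots> \<longleftrightarrow> s \<in> row_base ?x"
      using False nonzero uminus_in_nonzero_squares_iff[OF CARD_mod4, of "a * (s - ?x)"]
      by (simp add: row_base_def)
    finally show ?thesis .
  qed
  have right: "Inr s \<in> row_symbols (q + 1) T i \<longleftrightarrow> s \<in> row_base ?x" for s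
  proof -
    have "Inr s \<in> row_symbols (q + 1) T i \<longleftrightarrow> (\<exists>d. d \<notin> nonzero_squares \<and> s = ?x + d / b)"
      unfolding * by (auto split: if_splits)
    also have "\<dots> \<longleftrightarrow> b * (s - ?x) \<notin> nonzero_squares"
    proof
      assume "b * (s - ?x) \<notin> nonzero_squares"
      moreover have "s = ?x + b * (s - ?x) / b"
        using nonzero by simp
      ultimately show "\<exists>d. d \<notin> nonzero_squares \<and> s = ?x + d / b" by blast
    qed (use nonzero in auto)
    also have "\<dots> \<longleftrightarrow> s \<in> row_base ?x"
      using mult_in_nonzero_squares_cong[OF mult_ab] by (simp add: row_base_def)
    finally show ?thesis .
  qed
  have "z \<in> row_symbols (q + 1) T i \<longleftrightarrow> z \<in> row_base ?x <+> row_base ?x" for z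
    by (cases z) (use left right in auto)
  then show ?thesis
    by blast
qed

text \<open>Now the row varies, and \<open>w i = w j + d\<close> with \<open>d\<close> running
  through the field. Each half of the column leads to a linear equation for \<open>d\<close>, and
  the coefficients of both solutions lie in the square class of \<open>a * (a - 1)\<close>.\<close>

lemma col_symbols_T:
  assumes "j \<in> {1..q}"
  shows "col_symbols q T j = col_base (w j) <+> - col_base (w j)"
proof -
  let ?y = "w j"
  have *: "z \<in> col_symbols q T j \<longleftrightarrow>
      (\<exists>d. z = (if d \<in> nonzero_squares then Inl (?y + d - d / a) else Inr (?y + d + d / b)))"
    (is "_ \<longleftrightarrow> (\<exists>d. z = ?f d)") for z
  proof
    assume "z \<in> col_symbols q T j"
    then obtain i where "z = T i j"
      by (auto simp: col_symbols_def)
    then have "z = ?f (w i - w j)"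
      using T_eq(1)[OF assms, of i] by simp
    then show "\<exists>d. z = ?f d" ..
  next
    assume "\<exists>d. z = ?f d"
    then obtain d where d: "z = ?f d" ..
    obtain i where i: "i \<in> {1..q}" "w i = ?y + d"
      by (rule w_surj)
    then have "z = T i j"
      using d T_eq(1)[OF assms, of i] by simp
    with i show "z \<in> col_symbols q T j"
      by (auto simp: col_symbols_def)
  qed
  have sol_a: "s = ?y + d - d / a \<longleftrightarrow> d = a / (a - 1) * (s - ?y)" for s d
    using nonzero by (auto simp: field_simps)
  have sol_b: "s = ?y + d + d / b \<longleftrightarrow> d = b / (b + 1) * (s - ?y)" for s d
    using nonzero by (auto simp: field_simps)
  have cong_a: "a / (a - 1) * z \<in> nonzero_squares \<longleftrightarrow> a * (a - 1) * z \<in> nonzero_squares" for z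
  proof (rule mult_in_nonzero_squares_cong)
    have "a / (a - 1) * (a * (a - 1)) = a\<^sup>2"
      using nonzero by (simp add: power2_eq_square)
    then show "a / (a - 1) * (a * (a - 1)) \<in> nonzero_squares"
      using nonzero power2_in_nonzero_squares by metis
  qed
  have cong_b: "b / (b + 1) * z \<in> nonzero_squares \<longleftrightarrow> a * (a - 1) * z \<in> nonzero_squares" for z
  proof (rule mult_in_nonzero_squares_cong)
    \<comment> \<open>Here \<open>u\<close> and \<open>c\<close> stand for \<open>b + 1\<close> and
      \<open>a - 1\<close>: up to a square factor, the product of the two coefficients is the
      product of the two given squares.\<close>
    have "b / u * (a * c) = (a * b) * (c * u) * (inverse u)\<^sup>2" if "u \<noteq> 0" for u c
      using that by (simp add: power2_eq_square field_simps)
    then have "b / (b + 1) * (a * (a - 1)) = (a * b) * ((a - 1) * (b + 1)) * (inverse (b + 1))\<^sup>2"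
      using nonzero by blast
    also have "\<dots> \<in> nonzero_squares"
      using nonzero by (intro nonzero_squares_mult mult_ab mult_pm_one power2_in_nonzero_squares) simp
    finally show "b / (b + 1) * (a * (a - 1)) \<in> nonzero_squares" .
  qed
  have left: "Inl s \<in> col_symbols q T j \<longleftrightarrow> s \<in> col_base ?y" for s
  proof -
    have "Inl s \<in> col_symbols q T j \<longleftrightarrow> (\<exists>d\<in>nonzero_squares. s = ?y + d - d / a)"
      unfolding * by (auto split: if_splits)
    also have "\<dots> \<longleftrightarrow> s \<in> col_base ?y"
      unfolding sol_a col_base_def using cong_a by auto
    finally show ?thesis .
  qed
  have right: "Inr s \<in> col_symbols q T j \<longleftrightarrow> s \<notin> col_base ?y" for s
  proof -
    have "Inr s \<in> col_symbols q T j \<longleftrightarrow> (\<exists>d. d \<notin> nonzero_squares \<and> s = ?y + d + d / b)"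
      unfolding * by (auto split: if_splits)
    also have "\<dots> \<longleftrightarrow> s \<notin> col_base ?y"
      unfolding sol_b col_base_def using cong_b by auto
    finally show ?thesis .
  qed
  have "z \<in> col_symbols q T j \<longleftrightarrow> z \<in> col_base ?y <+> - col_base ?y" for z
    by (cases z) (auto simp: left right)
  then show ?thesis
    by blast
qed

lemma col_symbols_T_last: "col_symbols q T (Suc q) = UNIV <+> {}"
proof -
  have "col_symbols q T (Suc q) = Inl ` w ` {1..q}"
    by (simp add: col_symbols_def T_eq(2) image_image)
  also have "w ` {1..q} = UNIV"
    using bij_w by (rule bij_betw_imp_surj_on)
  finally show ?thesis
    by (simp add: Plus_def)
qed

text \<open>The last column fits the same shape with \<open>A = UNIV\<close>. Hence every column
  contains exactly one of \<open>Inl s\<close> and \<open>Inr s\<close> for each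
  \<open>s\<close>.\<close>

lemma col_symbols_T_cases:
  assumes "j \<in> {1..q + 1}"
  obtains A where "col_symbols q T j = A <+> - A"
proof (cases "j = Suc q")
  case True
  then have "col_symbols q T j = UNIV <+> - UNIV"
    using col_symbols_T_last by simp
  then show ?thesis by (rule that)
next
  case False
  then show ?thesis
    using assms that col_symbols_T[of j] by simp
qed

section \<open>Counting for the triple array conditions\<close>

lemma card_row_base: "2 * card (row_base x) = q + 1"
proof -
  have "card (row_base x) = card (- nonzero_squares :: 'a set)"
    using card_affine_squares(2) nonzero by (simp add: row_base_def)
  moreover have "card (nonzero_squares :: 'a set) + card (- nonzero_squares :: 'a set) = q"
    using card_Un_disjoint[of nonzero_squares "- nonzero_squares :: 'a set"] CARD_eq by simp
  moreover have "q > 0"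
    using mod4 by (cases q) auto
  ultimately show ?thesis
    using card_nonzero_squares[OF CARD_mod4] CARD_eq by linarith
qed

text \<open>The two halves of the row have (q + 1)/2 symbols each, so there are as many symbols as
  columns and none can repeat.\<close>

lemma inj_on_row: "inj_on (T i) {1..q + 1}"
proof (rule eq_card_imp_inj_on)
  have "T i ` {1..q + 1} = row_base (w i) <+> row_base (w i)"
    unfolding row_symbols_T[symmetric] row_symbols_def ..
  then show "card (T i ` {1..q + 1}) = card {1..q + 1}"
    using card_row_base[of "w i"] by (simp add: card_Plus)
qed simp

lemma inj_on_col:
  assumes "j \<in> {1..q + 1}"
  shows "inj_on (\<lambda>i. T i j) {1..q}"
proof (rule eq_card_imp_inj_on)
  obtain A where A: "col_symbols q T j = A <+> - A"
    using col_symbols_T_cases[OF assms] .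
  have "card A + card (- A) = q"
    using card_Un_disjoint[of A "- A"] CARD_eq by simp
  then have "card (col_symbols q T j) = q"
    unfolding A by (simp add: card_Plus)
  then show "card ((\<lambda>i. T i j) ` {1..q}) = card {1..q}"
    by (simp add: col_symbols_def)
qed simp

text \<open>No row repeats a symbol, so occurrences correspond to rows containing it.
  \<open>Inl s\<close> and \<open>Inr s\<close> lie in the same rows, which are counted through
  their field elements \<open>w i\<close>.\<close>

lemma replication:
  "card {(i, j). i \<in> {1..q} \<and> j \<in> {1..q + 1} \<and> T i j = z} = card (- nonzero_squares :: 'a set)"
proof -
  let ?S = "{(i, j). i \<in> {1..q} \<and> j \<in> {1..q + 1} \<and> T i j = z}"
  obtain s where z: "z = Inl s \<or> z = Inr s"
    by (cases z) auto
  then have row: "z \<in> row_symbols (q + 1) T i \<longleftrightarrow> s \<in> row_base (w i)" for i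
    unfolding row_symbols_T by auto
  have "inj_on fst ?S"
    using inj_onD[OF inj_on_row] by (intro inj_onI) (clarsimp, metis atLeastAtMost_iff)
  then have "card ?S = card (fst ` ?S)"
    by (rule card_image[symmetric])
  also have "fst ` ?S = {i \<in> {1..q}. z \<in> row_symbols (q + 1) T i}"
    by (force simp: row_symbols_def)
  also have "\<dots> = {i \<in> {1..q}. s \<in> row_base (w i)}"
    unfolding row ..
  also have "card \<dots> = card (w ` {i \<in> {1..q}. s \<in> row_base (w i)})"
  proof (rule card_image[symmetric])
    show "inj_on w {i \<in> {1..q}. s \<in> row_base (w i)}"
      using bij_betw_imp_inj_on[OF bij_w] by (rule inj_on_subset) auto
  qed
  also have "w ` {i \<in> {1..q}. s \<in> row_base (w i)} = w ` {1..q} \<inter> {x. s \<in> row_base x}"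
    by auto
  also have "\<dots> = {x. s \<in> row_base x}"
    unfolding bij_betw_imp_surj_on[OF bij_w] by simp
  also have "card \<dots> = card (- nonzero_squares :: 'a set)"
    using card_affine_squares(3) nonzero by (simp add: row_base_def)
  finally show ?thesis .
qed

text \<open>The row has the same set in both halves, the column has \<open>A\<close> and its
  complement, so each element of \<open>row_base (w i)\<close> is counted exactly once.\<close>

lemma card_row_Int_col:
  assumes "j \<in> {1..q + 1}"
  shows "card (row_symbols (q + 1) T i \<inter> col_symbols q T j) = (q + 1) div 2"
proof -
  obtain A where A: "col_symbols q T j = A <+> - A"
    using col_symbols_T_cases[OF assms] .
  have "card (row_symbols (q + 1) T i \<inter> col_symbols q T j)
      = card (row_base (w i) \<inter> A) + card (row_base (w i) \<inter> - A)"
    unfolding A row_symbols_T Plus_Int by (simp add: card_Plus)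
  also have "\<dots> = card (row_base (w i))"
    by (subst card_Un_disjoint[symmetric]) (auto intro: arg_cong[where f = card])
  finally show ?thesis
    using card_row_base[of "w i"] by simp
qed

lemma card_row_Int_row:
  assumes "i \<in> {1..q}" "i' \<in> {1..q}" "i \<noteq> i'"
  shows "card (row_symbols (q + 1) T i \<inter> row_symbols (q + 1) T i')
    = 2 * (card {d::'a. d \<in> nonzero_squares \<and> d + 1 \<in> nonzero_squares} + 1)"
  unfolding row_symbols_T Plus_Int
  using card_affine_nonsquares_Int[OF CARD_mod4 nonzero(1) w_neq[OF assms]]
  by (simp add: card_Plus row_base_def)

lemma card_col_base: "card (col_base y) = (q - 1) div 2"
  using card_affine_squares(1)[of "a * (a - 1)" y] card_nonzero_squares[OF CARD_mod4]
    nonzero CARD_eq by (simp add: col_base_def)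

lemma card_col_Int_last:
  assumes "j \<in> {1..q}"
  shows "card (col_symbols q T j \<inter> col_symbols q T (Suc q)) = (q - 1) div 2"
  unfolding col_symbols_T[OF assms] col_symbols_T_last Plus_Int
  using card_col_base by (simp add: card_Plus)

lemma card_col_Int_col:
  assumes "j \<in> {1..q}" "j' \<in> {1..q}" "j \<noteq> j'"
  shows "card (col_symbols q T j \<inter> col_symbols q T j') = (q - 1) div 2"
proof -
  let ?m = "card {d::'a. d \<in> nonzero_squares \<and> d + 1 \<in> nonzero_squares}"
  have c: "a * (a - 1) \<noteq> 0"
    using nonzero by simp
  have compl: "- col_base y = {s. (a * (a - 1)) * (s - y) \<notin> nonzero_squares}" for y
    by (auto simp: col_base_def)
  have "card (col_base (w j) \<inter> col_base (w j')) = ?m"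
    using card_affine_squares_Int[OF CARD_mod4 c w_neq[OF assms]] by (simp add: col_base_def)
  moreover have "card (- col_base (w j) \<inter> - col_base (w j')) = ?m + 1"
    unfolding compl using card_affine_nonsquares_Int[OF CARD_mod4 c w_neq[OF assms]] .
  ultimately have "card (col_symbols q T j \<inter> col_symbols q T j') = 2 * ?m + 1"
    unfolding col_symbols_T[OF assms(1)] col_symbols_T[OF assms(2)] Plus_Int
    by (simp add: card_Plus)
  \<comment> \<open>Since \<open>?m\<close> is (q - 3)/4, the sum \<open>2 * ?m + 1\<close> is (q -
    1)/2, which agrees with the value for the last column.\<close>
  then show ?thesis
    using card_square_differences_value[OF CARD_mod4] CARD_eq by simp
qed

lemma triple_array_T: "triple_array q (q + 1) (2 * q) UNIV T"
  unfolding triple_array_def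
\<comment> \<open>The constants left open by \<open>exI\<close> are determined by the counting
  lemmas that solve the goals.\<close>
proof (intro conjI exI ballI impI)
  show "card (UNIV :: ('a + 'a) set) = 2 * q"
    using CARD_eq by simp
  show "card (col_symbols q T j \<inter> col_symbols q T j') = (q - 1) div 2"
    if "j \<in> {1..q + 1}" "j' \<in> {1..q + 1}" "j \<noteq> j'" for j j'
  proof -
    consider "j = Suc q" "j' \<in> {1..q}" | "j' = Suc q" "j \<in> {1..q}" | "j \<in> {1..q}" "j' \<in> {1..q}"
      using \<open>j \<in> {1..q + 1}\<close> \<open>j' \<in> {1..q + 1}\<close> \<open>j \<noteq> j'\<close> by fastforce
    then show ?thesis
      using card_col_Int_col card_col_Int_last \<open>j \<noteq> j'\<close> by cases (simp_all add: Int_commute)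
  qed
qed (rule finite UNIV_I inj_on_row replication
    | erule inj_on_col card_row_Int_col
    | erule (2) card_row_Int_row)+

section \<open>Resolvability\<close>

lemma resolvable_T: "resolvable q (q + 1) (2 * q) UNIV T"
proof -
  \<comment> \<open>With q = 4m - 1, the replication number is 2m, \<open>lambda_rrc\<close> is m
    and the group size is 2.\<close>
  define m where "m = (q + 1) div 4"
  have q: "q = 4 * m - 1" "m > 0"
    using mod4 by (simp_all add: m_def, presburger+)
  define e where "e = real q * real (q + 1) / real (2 * q)"
  have rq: "real q = 4 * real m - 1" and "q \<noteq> 0"
    using q by (simp_all add: of_nat_diff)
  then have e: "e = 2 * real m"
    by (simp add: e_def field_simps)
  have lam: "e * (e - 1) / (real q - 1) = real m"
    using q(2) by (simp add: e rq field_simps)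
  have k: "real (q + 1) / e = 2"
    using q(2) by (simp add: e rq)
  \<comment> \<open>A column \<open>A <+> - A\<close> meets each pair in one symbol; a row contains
    both symbols of a pair or neither, as its two halves agree.\<close>
  let ?G = "\<lambda>s::'a. {Inl s, Inr s :: 'a + 'a}"
  have "inj ?G"
    by (auto simp: inj_def doubleton_eq_iff)
  then have card_P: "card (range ?G) = q"
    using CARD_eq by (simp add: card_image)
  have part: "partition_on UNIV (range ?G)"
  proof (rule partition_onI)
    show "\<Union> (range ?G) = UNIV"
    proof -
      have "z \<in> \<Union> (range ?G)" for z
        by (cases z) auto
      then show ?thesis by blast
    qed
  qed (auto simp: disjnt_def)
  have col: "\<exists>!x. x \<in> G \<and> x \<in> col_symbols q T j"
    if j: "j \<in> {1..q + 1}" and G: "G \<in> range ?G" for j G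
  proof -
    obtain A where "col_symbols q T j = A <+> - A"
      using col_symbols_T_cases[OF j] .
    with G show ?thesis
      by auto
  qed
  have row: "x \<in> row_symbols (q + 1) T i \<longleftrightarrow> y \<in> row_symbols (q + 1) T i"
    if "G \<in> range ?G" "x \<in> G" "y \<in> G" for G x y i
    using that unfolding row_symbols_T by auto
  have card_G: "real (card G) = 2" if "G \<in> range ?G" for G
    using that by auto
  show ?thesis
    unfolding resolvable_def Let_def e_def[symmetric] lam k
  proof (intro conjI exI[of _ "range ?G"] ballI)
    show "real m \<in> \<int>" "(2::real) \<in> \<int>"
      by simp_all
  qed (fact part card_P | erule card_G | erule (1) col | erule (2) row)+
qed

end

theorem theorem8:
  fixes w :: "nat \<Rightarrow> 'a::{field,finite}" and a b :: 'a and q :: nat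
  assumes "CARD('a) = q" and "q \<ge> 7" and "q mod 4 = 3"
    and "bij_betw w {1..q} UNIV" and "w 1 = 0"
    and "a \<noteq> 0" and "b \<noteq> 0"
    and "(a - 1) * (b + 1) \<in> nonzero_squares" and "a * b \<in> nonzero_squares"
  shows "triple_array q (q + 1) (2 * q) (UNIV :: ('a + 'a) set) (paley_array w a b) \<and>
         resolvable q (q + 1) (2 * q) (UNIV :: ('a + 'a) set) (paley_array w a b)"
proof -
  interpret paley_parameters w a b q
    using assms by unfold_locales
  show ?thesis
    using triple_array_T resolvable_T ..
qed

end
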